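(* Let $a,b>1$ be real numbers. Define the curves $$c_a(u)=\frac{1}{\sqrt{1+a^2}}\,(a,0,-1,0)\cdot\gamma_a(u),\qquad c_b(v)=\frac{1}{\sqrt{1+b^2}}\,T(\gamma_b(v))\cdot(b,0,0,-1)$$ in $\mathbb{S}^3$, where $\cdot$ is quaternion multiplication, $\gamma_r(u)=\frac{1}{\sqrt{1+r^2}}\left(r\cos\frac{u}{r},\,r\sin\frac{u}{r},\,\cos ru,\,\sin ru\right)$, and $T(x_1,x_2,x_3,x_4)=(x_1,x_2,x_4,x_3)$. Then the map $X:U\subset\mathbb{R}^2\to\mathbb{S}^3$ given by $X(u,v)=c_a(u)\cdot c_b(v)$ is a parametrization of a flat surface in $\mathbb{S}^3$, whose first and second fundamental forms are given by $$I=du^2+2\cos\left(\left(\tfrac{1-a^2}{a}\right)u+\left(\tfrac{b^2-1}{b}\right)v+c\right)du\,dv+dv^2,$$ $$II=2\sin\left(\left(\tfrac{1-a^2}{a}\right)u+\left(\tfrac{b^2-1}{b}\right)v+c\right)du\,dv,$$ where $c$ is a constant. Moreover, up to rigid motions, $X$ is invariant under helicoidal motions.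
   Context: $\mathbb{S}^3$ is the unit sphere of $\mathbb{R}^4$ with its standard metric. $\mathbb{R}^4$ is identified with the quaternions by $(x_1,x_2,x_3,x_4)\leftrightarrow x_1+x_2 i+x_3 j+x_4 k$, so $\mathbb{S}^3$ is the set of unit quaternions. $U$ is an open set on which $X$ is an immersion. A surface is flat if the Gauss curvature of its induced metric vanishes identically. For $\alpha,\beta\in\mathbb{R}$, the helicoidal $1$-parameter group of isometries of $\mathbb{S}^3$ is $$\phi_{\alpha,\beta}(t)=\begin{pmatrix}\cos\alpha t&-\sin\alpha t&0&0\\ \sin\alpha t&\cos\alpha t&0&0\\ 0&0&\cos\beta t&-\sin\beta t\\ 0&0&\sin\beta t&\cos\beta t\end{pmatrix},$$ with the standing assumption $\alpha\neq\pm\beta$; its elements are the helicoidal motions. "Up to rigid motions, $X$ is invariant under helicoidal motions" means that, after composing $X$ with an isometry of $\mathbb{S}^3$ to obtain a map $Y$, there are real numbers $\alpha,\beta$ such that $\phi_{\alpha,\beta}(t)\,Y(u,v)=Y(u(t),v(t))$ for smooth functions $u(t),v(t)$ with $u(0)=u$, $v(0)=v$ (the formula for $Y$ being understood on all of $\mathbb{R}^2$).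
   Formalization: In both I and II the coefficient of u in the phase is (a²−1)/a instead of the printed (1−a²)/a; with the curves as defined, the printed formula for I fails on every nonempty open U. *)

theory Defs
  imports "HOL-Analysis.Analysis"
begin

section \<open>Quaternions and the two curves\<close>

text \<open>The quaternion \<open>x1 + x2 i + x3 j + x4 k\<close> is the vector \<open>(x1, x2, x3, x4)\<close>, with
  \<open>i j = k\<close>, \<open>j k = i\<close>, \<open>k i = j\<close>.  The 3-sphere is \<open>sphere (0 :: real^4) 1\<close>.\<close>

definition qmult :: "real^4 \<Rightarrow> real^4 \<Rightarrow> real^4"  (infixl \<open>\<star>\<close> 70) where
  "x \<star> y = vector
     [x$1 * y$1 - x$2 * y$2 - x$3 * y$3 - x$4 * y$4,
      x$1 * y$2 + x$2 * y$1 + x$3 * y$4 - x$4 * y$3,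
      x$1 * y$3 - x$2 * y$4 + x$3 * y$1 + x$4 * y$2,
      x$1 * y$4 + x$2 * y$3 - x$3 * y$2 + x$4 * y$1]"

definition gamma_curve :: "real \<Rightarrow> real \<Rightarrow> real^4" where
  "gamma_curve r u =
     (1 / sqrt (1 + r\<^sup>2)) *\<^sub>R vector [r * cos (u / r), r * sin (u / r), cos (r * u), sin (r * u)]"

definition swap34 :: "real^4 \<Rightarrow> real^4" where
  "swap34 x = vector [x$1, x$2, x$4, x$3]"

definition curve_left :: "real \<Rightarrow> real \<Rightarrow> real^4" where
  "curve_left a u = (1 / sqrt (1 + a\<^sup>2)) *\<^sub>R (vector [a, 0, -1, 0] \<star> gamma_curve a u)"

definition curve_right :: "real \<Rightarrow> real \<Rightarrow> real^4" where
  "curve_right b v = (1 / sqrt (1 + b\<^sup>2)) *\<^sub>R (swap34 (gamma_curve b v) \<star> vector [b, 0, 0, -1])"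

definition product_surface :: "real \<Rightarrow> real \<Rightarrow> real^2 \<Rightarrow> real^4" where
  "product_surface a b p = curve_left a (p$1) \<star> curve_right b (p$2)"


section \<open>Smooth maps and immersions\<close>

text \<open>On an open set \<open>S\<close>, \<open>Ck_on n f S\<close> says that all iterated partial derivatives of \<open>f\<close> of
  order at most \<open>n\<close> exist and are continuous on \<open>S\<close>.\<close>

fun Ck_on :: "nat \<Rightarrow> ('a::euclidean_space \<Rightarrow> 'b::real_normed_vector) \<Rightarrow> 'a set \<Rightarrow> bool" where
  "Ck_on 0 f S \<longleftrightarrow> continuous_on S f"
| "Ck_on (Suc n) f S \<longleftrightarrow>
     (\<forall>x\<in>S. f differentiable (at x)) \<and>
     (\<forall>e\<in>Basis. Ck_on n (\<lambda>x. frechet_derivative f (at x) e) S)"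

definition smooth_on :: "'a::euclidean_space set \<Rightarrow> ('a \<Rightarrow> 'b::real_normed_vector) \<Rightarrow> bool" where
  "smooth_on S f \<longleftrightarrow> (\<forall>n. Ck_on n f S)"

definition immersion_on :: "'a::euclidean_space set \<Rightarrow> ('a \<Rightarrow> 'b::real_normed_vector) \<Rightarrow> bool" where
  "immersion_on S f \<longleftrightarrow>
     (\<forall>x\<in>S. f differentiable (at x) \<and> inj (frechet_derivative f (at x)))"


section \<open>Fundamental forms and Gauss curvature\<close>

definition partial :: "2 \<Rightarrow> (real^2 \<Rightarrow> 'b::real_normed_vector) \<Rightarrow> real^2 \<Rightarrow> 'b" where
  "partial i f p = vector_derivative (\<lambda>t. f (p + t *\<^sub>R axis i 1)) (at 0)"

text \<open>Symmetric bilinear forms on the parameter plane are given by their matrices in the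
  coordinates \<open>(u, v)\<close>: \<open>E du\<^sup>2 + 2 F du dv + G dv\<^sup>2\<close> is \<open>form_matrix E F G\<close>.\<close>

definition form_matrix :: "real \<Rightarrow> real \<Rightarrow> real \<Rightarrow> real^2^2" where
  "form_matrix E F G = vector [vector [E, F], vector [F, G]]"

definition first_form :: "(real^2 \<Rightarrow> real^4) \<Rightarrow> real^2 \<Rightarrow> real^2^2" where
  "first_form X p = (\<chi> i j. partial i X p \<bullet> partial j X p)"

definition unit_normal_on :: "(real^2) set \<Rightarrow> (real^2 \<Rightarrow> real^4) \<Rightarrow> (real^2 \<Rightarrow> real^4) \<Rightarrow> bool" where
  "unit_normal_on U X N \<longleftrightarrow> smooth_on U N \<and>
     (\<forall>p\<in>U. norm (N p) = 1 \<and> N p \<bullet> X p = 0 \<and> (\<forall>i. N p \<bullet> partial i X p = 0))"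

text \<open>Second fundamental form of a surface in the 3-sphere with unit normal field \<open>N\<close>.  The
  Levi-Civita connection of the sphere is the tangential part of the flat one; since \<open>N\<close> is tangent
  to the sphere, the ambient second derivative may be paired with \<open>N\<close> directly.\<close>

definition second_form ::
    "(real^2 \<Rightarrow> real^4) \<Rightarrow> (real^2 \<Rightarrow> real^4) \<Rightarrow> real^2 \<Rightarrow> real^2^2" where
  "second_form X N p = (\<chi> i j. partial i (partial j X) p \<bullet> N p)"

text \<open>Christoffel symbol with upper index \<open>k\<close> and lower indices \<open>i\<close>, \<open>j\<close>.\<close>

definition christoffel :: "(real^2 \<Rightarrow> real^2^2) \<Rightarrow> 2 \<Rightarrow> 2 \<Rightarrow> 2 \<Rightarrow> real^2 \<Rightarrow> real" where
  "christoffel g k i j p =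
     (\<Sum>l\<in>UNIV. matrix_inv (g p) $ k $ l *
        (partial i (\<lambda>q. g q $ j $ l) p + partial j (\<lambda>q. g q $ i $ l) p
         - partial l (\<lambda>q. g q $ i $ j) p)) / 2"

text \<open>Component along the coordinate field of index \<open>l\<close> of the curvature tensor
  \<open>R(\<partial>i, \<partial>j) \<partial>k = \<nabla>i \<nabla>j \<partial>k - \<nabla>j \<nabla>i \<partial>k\<close>.\<close>

definition riemann :: "(real^2 \<Rightarrow> real^2^2) \<Rightarrow> 2 \<Rightarrow> 2 \<Rightarrow> 2 \<Rightarrow> 2 \<Rightarrow> real^2 \<Rightarrow> real" where
  "riemann g l i j k p =
     partial i (christoffel g l j k) p - partial j (christoffel g l i k) p
     + (\<Sum>m\<in>UNIV. christoffel g l i m p * christoffel g m j k p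
                - christoffel g l j m p * christoffel g m i k p)"

text \<open>\<open>K = g(R(\<partial>1, \<partial>2) \<partial>2, \<partial>1) / det g\<close>.\<close>

definition gauss_curvature :: "(real^2 \<Rightarrow> real^2^2) \<Rightarrow> real^2 \<Rightarrow> real" where
  "gauss_curvature g p = (\<Sum>l\<in>UNIV. g p $ 1 $ l * riemann g l 1 2 2 p) / det (g p)"

definition flat_surface_in_S3 :: "(real^2) set \<Rightarrow> (real^2 \<Rightarrow> real^4) \<Rightarrow> bool" where
  "flat_surface_in_S3 U X \<longleftrightarrow>
     X ` U \<subseteq> sphere 0 1 \<and> smooth_on U X \<and> immersion_on U X \<and>
     (\<forall>p\<in>U. gauss_curvature (first_form X) p = 0)"


section \<open>Isometries of the sphere and helicoidal motions\<close>

text \<open>On the unit sphere \<open>arccos (x \<bullet> y)\<close> is the geodesic distance.\<close>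

definition isometry_S3 :: "(real^4 \<Rightarrow> real^4) \<Rightarrow> bool" where
  "isometry_S3 F \<longleftrightarrow> bij_betw F (sphere 0 1) (sphere 0 1) \<and>
     (\<forall>x\<in>sphere 0 1. \<forall>y\<in>sphere 0 1. arccos (F x \<bullet> F y) = arccos (x \<bullet> y))"

definition helicoidal :: "real \<Rightarrow> real \<Rightarrow> real \<Rightarrow> real^4^4" where
  "helicoidal \<alpha> \<beta> t = vector
     [vector [cos (\<alpha> * t), - sin (\<alpha> * t), 0, 0],
      vector [sin (\<alpha> * t),   cos (\<alpha> * t), 0, 0],
      vector [0, 0, cos (\<beta> * t), - sin (\<beta> * t)],
      vector [0, 0, sin (\<beta> * t),   cos (\<beta> * t)]]"

definition helicoidally_invariant :: "(real^2 \<Rightarrow> real^4) \<Rightarrow> bool" where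
  "helicoidally_invariant Y \<longleftrightarrow>
     (\<exists>\<alpha> \<beta>. \<alpha> \<noteq> \<beta> \<and> \<alpha> \<noteq> - \<beta> \<and>
        (\<forall>u v. \<exists>f g :: real \<Rightarrow> real.
           smooth_on UNIV f \<and> smooth_on UNIV g \<and> f 0 = u \<and> g 0 = v \<and>
           (\<forall>t. helicoidal \<alpha> \<beta> t *v Y (vector [u, v]) = Y (vector [f t, g t]))))"

end

theory Submission
  imports Defs
begin

text \<open>All statements reduce to computations at the identity quaternion.  The curve \<open>c\<^sub>a\<close> has the
  velocity \<open>c\<^sub>a' = c\<^sub>a f\<close> with \<open>f(u) = i e\<^sup>i\<^sup>A\<^sup>u j\<close> and \<open>A = a - 1 / a\<close>, and \<open>c\<^sub>b\<close> has
  \<open>c\<^sub>b' = g c\<^sub>b\<close> with \<open>g(v) = e\<^sup>-\<^sup>i\<^sup>B\<^sup>v j\<close> and \<open>B = b - 1 / b\<close>.  Hence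
  \<open>X\<^sub>u = c\<^sub>a f c\<^sub>b\<close> and \<open>X\<^sub>v = c\<^sub>a g c\<^sub>b\<close> (lemma \<open>partial_product_surface\<close>), and a unit normal is
  \<open>N = - c\<^sub>a i c\<^sub>b\<close>, since \<open>f\<close> and \<open>g\<close> are orthogonal to \<open>1\<close> and \<open>i\<close>.  Translations by unit
  quaternions preserve the inner product, so the coefficients of the two fundamental forms are
  inner products of \<open>f\<close>, \<open>g\<close>, \<open>f f + f'\<close>, \<open>f g\<close>, \<open>g g + g'\<close> and \<open>- i\<close>.  This gives both forms, with
  \<open>c = pi / 2\<close>.

  The metric is \<open>du\<^sup>2 + 2 cos \<omega> du dv + dv\<^sup>2\<close> with \<open>\<omega>\<close> affine in \<open>u\<close> and \<open>v\<close>.  The immersion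
  hypothesis makes \<open>sin \<omega>\<close> nonzero, so the metric is invertible and the Christoffel symbols are
  explicit; the curvature \<open>- \<omega>\<^sub>u\<^sub>v / sin \<omega>\<close> vanishes (lemma \<open>gauss_curvature_Chebyshev\<close>).

  For the invariance, a rigid motion removes the constant factors of the two curves and leaves
  \<open>\<gamma>\<^sub>a(u) T(\<gamma>\<^sub>b(v))\<close>.  A helicoidal motion multiplies by an element of the circle \<open>e\<^sup>i\<^sup>s\<close>
  from the left and by another one from the right, and a shift of the parameter acts in this
  way on each factor.  In the product the two inner circle elements cancel if
  \<open>u\<close> and \<open>v\<close> are shifted by \<open>(b - 1 / b) t\<close> and \<open>- (a - 1 / a) t\<close>
  (lemma \<open>helicoidally_invariant_gamma_product\<close>).\<close>

section \<open>Quaternion algebra\<close>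

lemma vector_4 [simp]:
  "(vector [x, y, z, w] :: 'a::zero^4) $ 1 = x"
  "(vector [x, y, z, w] :: 'a::zero^4) $ 2 = y"
  "(vector [x, y, z, w] :: 'a::zero^4) $ 3 = z"
  "(vector [x, y, z, w] :: 'a::zero^4) $ 4 = w"
  unfolding vector_def by simp_all

lemma qmult_nth [simp]:
  "(x \<star> y) $ 1 = x$1 * y$1 - x$2 * y$2 - x$3 * y$3 - x$4 * y$4"
  "(x \<star> y) $ 2 = x$1 * y$2 + x$2 * y$1 + x$3 * y$4 - x$4 * y$3"
  "(x \<star> y) $ 3 = x$1 * y$3 - x$2 * y$4 + x$3 * y$1 + x$4 * y$2"
  "(x \<star> y) $ 4 = x$1 * y$4 + x$2 * y$3 - x$3 * y$2 + x$4 * y$1"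
  by (simp_all add: qmult_def)

lemma qmult_assoc: "(x \<star> y) \<star> z = x \<star> (y \<star> z)"
  by (simp add: vec_eq_iff forall_4 algebra_simps)

lemma bilinear_qmult: "bilinear (\<star>)"
  unfolding bilinear_def
  by (auto intro!: linearI simp: vec_eq_iff forall_4 algebra_simps)

interpretation qmult: bounded_bilinear "(\<star>)"
  using bilinear_qmult by (simp add: bilinear_conv_bounded_bilinear)

definition quat_conj :: "real^4 \<Rightarrow> real^4" where
  "quat_conj x = vector [x$1, - (x$2), - (x$3), - (x$4)]"

lemma quat_conj_nth [simp]:
  "quat_conj x $ 1 = x$1" "quat_conj x $ 2 = - (x$2)"
  "quat_conj x $ 3 = - (x$3)" "quat_conj x $ 4 = - (x$4)"
  by (simp_all add: quat_conj_def)

definition quat_one :: "real^4" where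
  "quat_one = vector [1, 0, 0, 0]"

lemma quat_one_nth [simp]:
  "quat_one $ 1 = 1" "quat_one $ 2 = 0" "quat_one $ 3 = 0" "quat_one $ 4 = 0"
  by (simp_all add: quat_one_def)

lemma qmult_quat_one [simp]: "quat_one \<star> x = x" "x \<star> quat_one = x"
  by (simp_all add: vec_eq_iff forall_4)

lemma inner_4: "x \<bullet> y = x$1 * y$1 + x$2 * y$2 + x$3 * y$3 + x$4 * y$4" for x y :: "real^4"
  by (simp add: inner_vec_def sum_4)

text \<open>Left and right translations by unit quaternions preserve the inner product.  All metric
  statements below reduce to this: an inner product of two vectors at a point of the surface is
  moved to the identity quaternion, where it is read off from coordinates.\<close>

lemma inner_qmult_left: "(x \<star> y) \<bullet> (x \<star> z) = (x \<bullet> x) * (y \<bullet> z)"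
  by (simp add: inner_4 algebra_simps)

lemma inner_qmult_right: "(y \<star> x) \<bullet> (z \<star> x) = (x \<bullet> x) * (y \<bullet> z)"
  by (simp add: inner_4 algebra_simps)

lemma quat_conj_qmult: "quat_conj x \<star> x = (x \<bullet> x) *\<^sub>R quat_one" "x \<star> quat_conj x = (x \<bullet> x) *\<^sub>R quat_one"
  by (simp_all add: vec_eq_iff forall_4 inner_4)

lemma inner_quat_conj [simp]: "quat_conj x \<bullet> quat_conj y = x \<bullet> y"
  by (simp add: inner_4)

lemma quat_conj_cancel:
  assumes "norm x = 1"
  shows "quat_conj x \<star> (x \<star> y) = y" "x \<star> (quat_conj x \<star> y) = y"
    "(y \<star> x) \<star> quat_conj x = y" "(y \<star> quat_conj x) \<star> x = y"
  using assms
  by (simp_all add: qmult_assoc[symmetric] quat_conj_qmult norm_eq_1)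
     (simp_all add: qmult_assoc quat_conj_qmult norm_eq_1)

lemma isometry_S3_qmult:
  assumes p: "norm p = 1" and q: "norm q = 1"
  shows "isometry_S3 (\<lambda>x. p \<star> x \<star> q)"
proof -
  have inner: "(p \<star> x \<star> q) \<bullet> (p \<star> y \<star> q) = x \<bullet> y" for x y
    using p q by (simp add: inner_qmult_left inner_qmult_right norm_eq_1)
  have inner': "(quat_conj p \<star> x \<star> quat_conj q) \<bullet> (quat_conj p \<star> y \<star> quat_conj q) = x \<bullet> y" for x y
    using p q by (simp add: inner_qmult_left inner_qmult_right norm_eq_1)
  have cancel: "quat_conj p \<star> (p \<star> x \<star> q) \<star> quat_conj q = x"
    "p \<star> (quat_conj p \<star> x \<star> quat_conj q) \<star> q = x" for x
    using quat_conj_cancel[OF p] quat_conj_cancel[OF q] by (simp_all add: qmult_assoc)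
  have "bij_betw (\<lambda>x. p \<star> x \<star> q) (sphere 0 1) (sphere 0 1)"
    by (rule bij_betw_byWitness[where f' = "\<lambda>x. quat_conj p \<star> x \<star> quat_conj q"])
       (auto simp: norm_eq_1 inner inner' cancel)
  then show ?thesis
    by (simp add: isometry_S3_def inner)
qed

definition quat_cis :: "real \<Rightarrow> real^4" where
  "quat_cis s = vector [cos s, sin s, 0, 0]"

lemma quat_cis_nth [simp]:
  "quat_cis s $ 1 = cos s" "quat_cis s $ 2 = sin s" "quat_cis s $ 3 = 0" "quat_cis s $ 4 = 0"
  by (simp_all add: quat_cis_def)

lemma quat_cis_zero [simp]: "quat_cis 0 = quat_one"
  by (simp add: vec_eq_iff forall_4)

lemma quat_cis_add: "quat_cis (s + t) = quat_cis s \<star> quat_cis t"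
  by (simp add: vec_eq_iff forall_4 cos_add sin_add)

text \<open>Write \<open>x = z + w j\<close> with \<open>z\<close> and \<open>w\<close> in the complex plane spanned by \<open>1\<close> and \<open>i\<close>.  Since
  \<open>j e\<^sup>i\<^sup>r = e\<^sup>-\<^sup>i\<^sup>r j\<close>, the product of \<open>e\<^sup>i\<^sup>s\<close>, \<open>x\<close> and \<open>e\<^sup>i\<^sup>r\<close> turns \<open>z\<close> by the angle
  \<open>s + r\<close> and \<open>w\<close> by \<open>s - r\<close>.  Hence a helicoidal motion multiplies by one circle element
  from each side.\<close>

lemma helicoidal_eq_qmult:
  "helicoidal (s + r) (s - r) t *v x = quat_cis (s * t) \<star> x \<star> quat_cis (r * t)"
  by (simp add: helicoidal_def vec_eq_iff forall_4 matrix_vector_mult_def sum_4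
      distrib_right left_diff_distrib cos_add sin_add cos_diff sin_diff algebra_simps)

section \<open>The two curves as orbits\<close>

text \<open>In the same notation \<open>gamma_curve r u\<close> is a multiple of \<open>r e\<^sup>i\<^sup>u\<^sup>/\<^sup>r + e\<^sup>i\<^sup>r\<^sup>u j\<close>, so
  it is an orbit of a helicoidal group: a shift of the parameter by \<open>d\<close> turns the two complex
  coordinates by \<open>d / r\<close> and \<open>r d\<close>, which are the sum and the difference of the two angles
  below.  For the curve with swapped coordinates the second angle is \<open>- r e\<close>, and therefore the
  two factors exchange their rates.\<close>

lemma gamma_curve_shift:
  assumes "r \<noteq> 0"
  shows "gamma_curve r (u + d) =
    quat_cis ((r + 1 / r) * d / 2) \<star> gamma_curve r u \<star> quat_cis (- ((r - 1 / r) * d / 2))"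
proof -
  define s t where "s = (r + 1 / r) * d / 2" and "t = - ((r - 1 / r) * d / 2)"
  have 1: "(u + d) / r = u / r + (s + t)" "r * (u + d) = r * u + (s - t)"
    using assms by (simp_all add: s_def t_def field_simps)
  show ?thesis
    unfolding s_def[symmetric] t_def[symmetric] gamma_curve_def 1
    by (simp add: vec_eq_iff forall_4 cos_add sin_add cos_diff sin_diff)
       (simp add: algebra_simps add_divide_distrib diff_divide_distrib)
qed

lemma swap34_gamma_curve_shift:
  assumes "r \<noteq> 0"
  shows "swap34 (gamma_curve r (v + e)) =
    quat_cis (- ((r - 1 / r) * e / 2)) \<star> swap34 (gamma_curve r v) \<star> quat_cis ((r + 1 / r) * e / 2)"
proof -
  define s t where "s = - ((r - 1 / r) * e / 2)" and "t = (r + 1 / r) * e / 2"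
  have 1: "(v + e) / r = v / r + (s + t)" "r * (v + e) = r * v - (s - t)"
    using assms by (simp_all add: s_def t_def field_simps)
  show ?thesis
    unfolding s_def[symmetric] t_def[symmetric] gamma_curve_def swap34_def 1
    by (simp add: vec_eq_iff forall_4 cos_add sin_add cos_diff sin_diff)
       (simp add: algebra_simps add_divide_distrib diff_divide_distrib)
qed

lemma norm_normalized_vector_4:
  assumes "x\<^sup>2 + y\<^sup>2 + z\<^sup>2 + w\<^sup>2 = 1 + r\<^sup>2"
  shows "norm ((1 / sqrt (1 + r\<^sup>2)) *\<^sub>R (vector [x, y, z, w] :: real^4)) = 1"
proof -
  have "1 + r\<^sup>2 > 0"
    by (simp add: add_pos_nonneg)
  then show ?thesis
    using assms
    by (simp add: norm_eq_sqrt_inner inner_4 power2_eq_square[symmetric] power_divide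
        flip: add_divide_distrib)
qed

lemma norm_gamma_curve: "norm (gamma_curve r u) = 1"
proof -
  have "r\<^sup>2 * ((cos (u / r))\<^sup>2 + (sin (u / r))\<^sup>2) + ((cos (r * u))\<^sup>2 + (sin (r * u))\<^sup>2) = 1 + r\<^sup>2"
    by simp
  then show ?thesis
    unfolding gamma_curve_def
    by (intro norm_normalized_vector_4) (simp only: power_mult_distrib distrib_left add.assoc)
qed

lemma norm_swap34 [simp]: "norm (swap34 x) = norm x"
  by (simp add: norm_eq_sqrt_inner inner_4 swap34_def)

lemma norm_qmult: "norm (x \<star> y) = norm x * norm y"
  by (simp add: norm_eq_sqrt_inner inner_4 real_sqrt_mult[symmetric] algebra_simps)

lemma norm_curve_left: "norm (curve_left a u) = 1"
proof -
  have "curve_left a u = ((1 / sqrt (1 + a\<^sup>2)) *\<^sub>R vector [a, 0, -1, 0]) \<star> gamma_curve a u"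
    by (simp add: curve_left_def qmult.scaleR_left)
  then show ?thesis
    by (simp add: norm_qmult norm_gamma_curve norm_normalized_vector_4 del: norm_scaleR)
qed

lemma norm_curve_right: "norm (curve_right b v) = 1"
proof -
  have "curve_right b v = swap34 (gamma_curve b v) \<star> ((1 / sqrt (1 + b\<^sup>2)) *\<^sub>R vector [b, 0, 0, -1])"
    by (simp add: curve_right_def qmult.scaleR_right)
  then show ?thesis
    by (simp add: norm_qmult norm_gamma_curve norm_normalized_vector_4 del: norm_scaleR)
qed

section \<open>Velocities of the two curves\<close>

lemma has_vector_derivative_vector_4:
  assumes "(x has_real_derivative x') F" "(y has_real_derivative y') F"
    "(z has_real_derivative z') F" "(w has_real_derivative w') F"
  shows "((\<lambda>t. vector [x t, y t, z t, w t] :: real^4) has_vector_derivative vector [x', y', z', w']) F"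
proof -
  have expand: "(vector [p, q, r, s] :: real^4)
      = p *\<^sub>R axis 1 1 + q *\<^sub>R axis 2 1 + r *\<^sub>R axis 3 1 + s *\<^sub>R axis 4 1" for p q r s
    by (simp add: vec_eq_iff forall_4 axis_def)
  show ?thesis
    unfolding expand
    by (intro has_vector_derivative_add bounded_linear.has_vector_derivative[OF bounded_linear_scaleR_left]
        assms[unfolded has_real_derivative_iff_has_vector_derivative])
qed

text \<open>The quaternion \<open>curve_left a u\<^sup>-\<^sup>1 \<star> curve_left' a u\<close>.  It is purely imaginary and
  orthogonal to \<open>i\<close>: it equals \<open>i e\<^sup>i\<^sup>A\<^sup>u j\<close> with \<open>A = a - 1 / a\<close>.\<close>

definition left_velocity :: "real \<Rightarrow> real \<Rightarrow> real^4" where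
  "left_velocity a u = vector [0, 0, - sin ((a - 1 / a) * u), cos ((a - 1 / a) * u)]"

text \<open>The quaternion \<open>curve_right' b v \<star> curve_right b v\<^sup>-\<^sup>1\<close>, which equals
  \<open>e\<^sup>-\<^sup>i\<^sup>B\<^sup>v j\<close> with \<open>B = b - 1 / b\<close>.\<close>

definition right_velocity :: "real \<Rightarrow> real \<Rightarrow> real^4" where
  "right_velocity b v = vector [0, 0, cos ((b - 1 / b) * v), - sin ((b - 1 / b) * v)]"

text \<open>The frequencies \<open>1 / r\<close> and \<open>r\<close> of the curve differ by \<open>r - 1 / r\<close>, so the addition
  theorems turn the quaternion product into the derivative.\<close>

lemma gamma_curve_derivative:
  assumes "r \<noteq> 0"
  shows "(gamma_curve r has_vector_derivative gamma_curve r u \<star> left_velocity r u) (at u)"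
proof -
  define A where "A = (r - 1 / r) * u"
  have add: "r * u = u / r + A" and diff: "u / r = r * u - A"
    using assms by (simp_all add: field_simps A_def)
  have "gamma_curve r u \<star> left_velocity r u = (1 / sqrt (1 + r\<^sup>2)) *\<^sub>R
      (vector [r * cos (u / r), r * sin (u / r), cos (r * u), sin (r * u)]
        \<star> vector [0, 0, - sin A, cos A])"
    by (simp add: gamma_curve_def left_velocity_def A_def qmult.scaleR_left)
  also have "vector [r * cos (u / r), r * sin (u / r), cos (r * u), sin (r * u)]
        \<star> vector [0, 0, - sin A, cos A] =
      vector [- sin (u / r), cos (u / r), - (r * sin (r * u)), r * cos (r * u)]"
  proof -
    have "cos (r * u) * sin A - sin (r * u) * cos A = - sin (u / r)"
      "cos (r * u) * cos A + sin (r * u) * sin A = cos (u / r)"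
      unfolding diff by (simp_all add: cos_diff sin_diff)
    moreover have "- (r * cos (u / r) * sin A) - r * sin (u / r) * cos A = - (r * sin (r * u))"
      "r * cos (u / r) * cos A - r * sin (u / r) * sin A = r * cos (r * u)"
      unfolding add by (simp_all add: cos_add sin_add algebra_simps)
    ultimately show ?thesis
      by (simp add: vec_eq_iff forall_4)
  qed
  finally have eq: "gamma_curve r u \<star> left_velocity r u = (1 / sqrt (1 + r\<^sup>2)) *\<^sub>R
      vector [- sin (u / r), cos (u / r), - (r * sin (r * u)), r * cos (r * u)]" .
  have "((\<lambda>u. (1 / sqrt (1 + r\<^sup>2)) *\<^sub>R
        (vector [r * cos (u / r), r * sin (u / r), cos (r * u), sin (r * u)] :: real^4))
      has_vector_derivative (1 / sqrt (1 + r\<^sup>2)) *\<^sub>R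
        vector [- sin (u / r), cos (u / r), - (r * sin (r * u)), r * cos (r * u)]) (at u)"
    using assms
    by (intro bounded_linear.has_vector_derivative[OF bounded_linear_scaleR_right]
        has_vector_derivative_vector_4) (auto intro!: derivative_eq_intros)
  then show ?thesis
    unfolding eq by (simp add: gamma_curve_def[abs_def])
qed

lemma swap34_gamma_curve_derivative:
  assumes "r \<noteq> 0"
  shows "((\<lambda>v. swap34 (gamma_curve r v)) has_vector_derivative
    right_velocity r v \<star> swap34 (gamma_curve r v)) (at v)"
proof -
  define B where "B = (r - 1 / r) * v"
  have add: "r * v = v / r + B" and diff: "v / r = r * v - B"
    using assms by (simp_all add: field_simps B_def)
  have swap: "swap34 (gamma_curve r v) = (1 / sqrt (1 + r\<^sup>2)) *\<^sub>R
      vector [r * cos (v / r), r * sin (v / r), sin (r * v), cos (r * v)]" for v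
    by (simp add: swap34_def gamma_curve_def vec_eq_iff forall_4)
  have "right_velocity r v \<star> swap34 (gamma_curve r v) = (1 / sqrt (1 + r\<^sup>2)) *\<^sub>R
      (vector [0, 0, cos B, - sin B]
        \<star> vector [r * cos (v / r), r * sin (v / r), sin (r * v), cos (r * v)])"
    by (simp add: swap right_velocity_def B_def qmult.scaleR_right)
  also have "vector [0, 0, cos B, - sin B]
        \<star> vector [r * cos (v / r), r * sin (v / r), sin (r * v), cos (r * v)] =
      vector [- sin (v / r), cos (v / r), r * cos (r * v), - (r * sin (r * v))]"
  proof -
    have "sin B * cos (r * v) - cos B * sin (r * v) = - sin (v / r)"
      "cos B * cos (r * v) + sin B * sin (r * v) = cos (v / r)"
      unfolding diff by (simp_all add: cos_diff sin_diff)
    moreover have "cos B * (r * cos (v / r)) - sin B * (r * sin (v / r)) = r * cos (r * v)"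
      "- (cos B * (r * sin (v / r))) - sin B * (r * cos (v / r)) = - (r * sin (r * v))"
      unfolding add by (simp_all add: cos_add sin_add algebra_simps)
    ultimately show ?thesis
      by (simp add: vec_eq_iff forall_4)
  qed
  finally have eq: "right_velocity r v \<star> swap34 (gamma_curve r v) = (1 / sqrt (1 + r\<^sup>2)) *\<^sub>R
      vector [- sin (v / r), cos (v / r), r * cos (r * v), - (r * sin (r * v))]" .
  show ?thesis
    unfolding eq unfolding swap using assms
    by (intro bounded_linear.has_vector_derivative[OF bounded_linear_scaleR_right]
        has_vector_derivative_vector_4) (auto intro!: derivative_eq_intros)
qed

text \<open>The constant left factor of \<open>curve_left\<close> commutes with right translations, and
  symmetrically for \<open>curve_right\<close>.  So these factors do not change the velocities.\<close>

lemma curve_left_derivative: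
  assumes "a \<noteq> 0"
  shows "(curve_left a has_vector_derivative curve_left a u \<star> left_velocity a u) (at u)"
  unfolding curve_left_def[abs_def] qmult.scaleR_left qmult_assoc
  by (intro bounded_linear.has_vector_derivative[OF bounded_linear_scaleR_right]
      bounded_linear.has_vector_derivative[OF qmult.bounded_linear_right] gamma_curve_derivative assms)

lemma curve_right_derivative:
  assumes "b \<noteq> 0"
  shows "(curve_right b has_vector_derivative right_velocity b v \<star> curve_right b v) (at v)"
  unfolding curve_right_def[abs_def] qmult.scaleR_right qmult_assoc[symmetric]
  by (intro bounded_linear.has_vector_derivative[OF bounded_linear_scaleR_right]
      bounded_linear.has_vector_derivative[OF qmult.bounded_linear_left]
      swap34_gamma_curve_derivative assms)

lemma left_velocity_derivative:
  "(left_velocity a has_vector_derivative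
    vector [0, 0, - ((a - 1 / a) * cos ((a - 1 / a) * u)), - ((a - 1 / a) * sin ((a - 1 / a) * u))]) (at u)"
  unfolding left_velocity_def[abs_def]
  by (rule has_vector_derivative_vector_4) (auto intro!: derivative_eq_intros)

lemma right_velocity_derivative:
  "(right_velocity b has_vector_derivative
    vector [0, 0, - ((b - 1 / b) * sin ((b - 1 / b) * v)), - ((b - 1 / b) * cos ((b - 1 / b) * v))]) (at v)"
  unfolding right_velocity_def[abs_def]
  by (rule has_vector_derivative_vector_4) (auto intro!: derivative_eq_intros)

section \<open>Closure properties of smooth maps\<close>

lemma Ck_on_cong:
  assumes "open S" "\<And>x. x \<in> S \<Longrightarrow> f x = g x" "Ck_on n f S"
  shows "Ck_on n g S"
  using assms(2,3)
proof (induction n arbitrary: f g)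
  case 0
  then show ?case
    by (simp cong: continuous_on_cong)
next
  case (Suc n)
  have diff: "f differentiable (at x)" if "x \<in> S" for x
    using Suc.prems that by simp
  have D: "(g has_derivative frechet_derivative f (at x)) (at x)" if "x \<in> S" for x
    by (rule has_derivative_transform_within_open[OF _ \<open>open S\<close> that Suc.prems(1)])
       (use diff[OF that] in \<open>simp add: frechet_derivative_works[symmetric]\<close>)
  have eq: "frechet_derivative f (at x) = frechet_derivative g (at x)" if "x \<in> S" for x
    by (rule frechet_derivative_at[OF D[OF that]])
  have "Ck_on n (\<lambda>x. frechet_derivative g (at x) e) S" if "e \<in> Basis" for e
    by (rule Suc.IH[of "\<lambda>x. frechet_derivative f (at x) e"]) (use Suc.prems that eq in auto)
  with D show ?case
    by (auto simp: differentiable_def)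
qed

lemma Ck_on_SucI:
  assumes "open S" "\<And>x. x \<in> S \<Longrightarrow> (f has_derivative f' x) (at x)"
    and "\<And>e. e \<in> Basis \<Longrightarrow> Ck_on n (\<lambda>x. f' x e) S"
  shows "Ck_on (Suc n) f S"
proof -
  have eq: "f' x = frechet_derivative f (at x)" if "x \<in> S" for x
    using assms(2)[OF that] by (rule frechet_derivative_at)
  have "Ck_on n (\<lambda>x. frechet_derivative f (at x) e) S" if "e \<in> Basis" for e
    using eq by (intro Ck_on_cong[OF \<open>open S\<close> _ assms(3)[OF that]]) simp
  with assms(2) show ?thesis
    by (auto simp: differentiable_def)
qed

lemma Ck_on_Suc_imp: "Ck_on (Suc n) f S \<Longrightarrow> Ck_on n f S"
proof (induction n arbitrary: f)
  case 0
  then show ?case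
    by (auto intro!: continuous_at_imp_continuous_on simp: differentiable_imp_continuous_within)
next
  case (Suc n)
  then show ?case
    by (metis Ck_on.simps(2))
qed

lemma Ck_on_const: "Ck_on n (\<lambda>x. c) S"
  by (induction n arbitrary: c) simp_all

lemma Ck_on_bounded_linear:
  assumes "open S" "bounded_linear f"
  shows "Ck_on n f S"
proof (cases n)
  case 0
  then show ?thesis
    using assms(2) by (simp add: linear_continuous_on)
next
  case (Suc m)
  show ?thesis
    unfolding Suc
    by (rule Ck_on_SucI[where f' = "\<lambda>_. f"])
       (simp_all add: assms Ck_on_const bounded_linear_imp_has_derivative)
qed

lemma Ck_on_add:
  assumes "open S" "Ck_on n f S" "Ck_on n g S"
  shows "Ck_on n (\<lambda>x. f x + g x) S"
  using assms(2,3)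
proof (induction n arbitrary: f g)
  case 0
  then show ?case
    by (simp add: continuous_on_add)
next
  case (Suc n)
  show ?case
    by (rule Ck_on_SucI[OF \<open>open S\<close>, where f' = "\<lambda>x h. frechet_derivative f (at x) h + frechet_derivative g (at x) h"])
       (use Suc in \<open>auto intro!: has_derivative_add simp: frechet_derivative_works[symmetric]\<close>)
qed

text \<open>The product rule expresses the derivative of the product by products of the factors and
  their derivatives, all of which are at least \<open>n\<close> times continuously differentiable.\<close>

lemma Ck_on_bounded_bilinear:
  assumes "bounded_bilinear B" "open S" "Ck_on n f S" "Ck_on n g S"
  shows "Ck_on n (\<lambda>x. B (f x) (g x)) S"
  using assms(3,4)
proof (induction n arbitrary: f g)
  case 0
  then show ?case
    by (simp add: bounded_bilinear.continuous_on[OF assms(1)])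
next
  case (Suc n)
  show ?case
  proof (rule Ck_on_SucI[OF \<open>open S\<close>])
    show "((\<lambda>x. B (f x) (g x)) has_derivative
        (\<lambda>h. B (f x) (frechet_derivative g (at x) h) + B (frechet_derivative f (at x) h) (g x))) (at x)"
      if "x \<in> S" for x
      using Suc.prems that
      by (intro bounded_bilinear.FDERIV[OF assms(1)]) (auto simp: frechet_derivative_works[symmetric])
    show "Ck_on n (\<lambda>x. B (f x) (frechet_derivative g (at x) e) + B (frechet_derivative f (at x) e) (g x)) S"
      if "e \<in> Basis" for e
    proof -
      have "Ck_on n f S" "Ck_on n g S"
        using Suc.prems by (blast intro: Ck_on_Suc_imp)+
      with Suc.prems that show ?thesis
        by (intro Ck_on_add[OF \<open>open S\<close>] Suc.IH) auto
    qed
  qed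
qed

text \<open>The phase \<open>d\<close> is arbitrary because differentiation increases it by \<open>pi / 2\<close>.  In this form
  the induction hypothesis applies to the derivative.\<close>

lemma Ck_on_sin_affine:
  fixes l :: "'a::euclidean_space \<Rightarrow> real"
  assumes "open S" "bounded_linear l"
  shows "Ck_on n (\<lambda>x. sin (l x + d)) S"
proof (induction n arbitrary: d)
  case 0
  then show ?case
    using linear_continuous_on[OF assms(2)] by (auto intro!: continuous_intros)
next
  case (Suc n)
  show ?case
  proof (rule Ck_on_SucI[OF \<open>open S\<close>])
    show "((\<lambda>x. sin (l x + d)) has_derivative (\<lambda>h. sin (l x + (d + pi / 2)) * l h)) (at x)" for x
    proof -
      have "sin (l x + (d + pi / 2)) = cos (l x + d)"
        by (simp add: sin_add cos_add algebra_simps)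
      then show ?thesis
        by (auto intro!: derivative_eq_intros bounded_linear_imp_has_derivative assms)
    qed
    show "Ck_on n (\<lambda>x. sin (l x + (d + pi / 2)) * l e) S" for e
      by (rule Ck_on_bounded_bilinear[OF bounded_bilinear_mult \<open>open S\<close> Suc.IH Ck_on_const])
  qed
qed

lemma smooth_on_const: "smooth_on S (\<lambda>x. c)"
  by (simp add: smooth_on_def Ck_on_const)

lemma smooth_on_bounded_linear:
  "open S \<Longrightarrow> bounded_linear f \<Longrightarrow> smooth_on S f"
  by (simp add: smooth_on_def Ck_on_bounded_linear)

lemma smooth_on_add:
  "open S \<Longrightarrow> smooth_on S f \<Longrightarrow> smooth_on S g \<Longrightarrow> smooth_on S (\<lambda>x. f x + g x)"
  by (simp add: smooth_on_def Ck_on_add)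

lemma smooth_on_bounded_bilinear:
  "bounded_bilinear B \<Longrightarrow> open S \<Longrightarrow> smooth_on S f \<Longrightarrow> smooth_on S g \<Longrightarrow>
    smooth_on S (\<lambda>x. B (f x) (g x))"
  by (simp add: smooth_on_def Ck_on_bounded_bilinear)

lemma smooth_on_sin:
  fixes l :: "'a::euclidean_space \<Rightarrow> real"
  shows "open S \<Longrightarrow> bounded_linear l \<Longrightarrow> smooth_on S (\<lambda>x. sin (l x))"
  using Ck_on_sin_affine[of S l _ 0] by (simp add: smooth_on_def)

lemma smooth_on_cos:
  fixes l :: "'a::euclidean_space \<Rightarrow> real"
  shows "open S \<Longrightarrow> bounded_linear l \<Longrightarrow> smooth_on S (\<lambda>x. cos (l x))"
  using Ck_on_sin_affine[of S l _ "pi / 2"] by (simp add: smooth_on_def sin_add)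

lemma smooth_on_vector_4:
  assumes "open S" "smooth_on S x" "smooth_on S y" "smooth_on S z" "smooth_on S w"
  shows "smooth_on S (\<lambda>p. vector [x p, y p, z p, w p] :: real^4)"
proof -
  have "(vector [x p, y p, z p, w p] :: real^4)
      = x p *\<^sub>R axis 1 1 + y p *\<^sub>R axis 2 1 + z p *\<^sub>R axis 3 1 + w p *\<^sub>R axis 4 1" for p
    by (simp add: vec_eq_iff forall_4 axis_def vector_def)
  then show ?thesis
    using assms
    by (auto intro!: smooth_on_add smooth_on_bounded_bilinear[OF bounded_bilinear_scaleR] smooth_on_const)
qed

section \<open>Curvature of a Chebyshev net with affine angle\<close>

lemma partial_eqI:
  assumes "((\<lambda>t. f (p + t *\<^sub>R axis i 1)) has_vector_derivative d) (at 0)"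
  shows "partial i f p = d"
  using assms by (simp add: partial_def vector_derivative_at)

lemma matrix_inv_unique:
  fixes A B :: "'a::semiring_1^'n^'n"
  assumes "A ** B = mat 1" "B ** A = mat 1"
  shows "matrix_inv A = B"
proof -
  have "A ** matrix_inv A = mat 1 \<and> matrix_inv A ** A = mat 1"
    unfolding matrix_inv_def by (rule someI[of _ B]) (use assms in simp)
  then show ?thesis
    by (metis assms(2) matrix_mul_assoc matrix_mul_lid matrix_mul_rid)
qed

lemma form_matrix_nth [simp]:
  "form_matrix E F G $ 1 $ 1 = E" "form_matrix E F G $ 1 $ 2 = F"
  "form_matrix E F G $ 2 $ 1 = F" "form_matrix E F G $ 2 $ 2 = G"
  by (simp_all add: form_matrix_def)

lemma matrix_inv_form_matrix:
  assumes "E * G - F\<^sup>2 \<noteq> 0"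
  shows "matrix_inv (form_matrix E F G) =
    form_matrix (G / (E * G - F\<^sup>2)) (- F / (E * G - F\<^sup>2)) (E / (E * G - F\<^sup>2))"
proof -
  define D where "D = E * G - F\<^sup>2"
  have EG: "E * G = D + F * F" "G * E = D + F * F"
    by (simp_all add: D_def power2_eq_square)
  have "D \<noteq> 0"
    using assms by (simp add: D_def)
  then show ?thesis
    unfolding D_def[symmetric]
    by (intro matrix_inv_unique;
        simp add: vec_eq_iff forall_2 matrix_matrix_mult_def sum_2 mat_def EG add_divide_distrib)
qed

text \<open>The parameters of a surface form a Chebyshev net if the coordinate lines have unit speed.
  The metric is then \<open>du\<^sup>2 + 2 cos \<omega> du dv + dv\<^sup>2\<close>, and its Gauss curvature is
  \<open>- \<omega>\<^sub>u\<^sub>v / sin \<omega>\<close>.  It vanishes for an angle \<open>\<omega>\<close> that is an affine function of \<open>u\<close> and \<open>v\<close>.\<close>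

context
  fixes \<omega> :: "real^2 \<Rightarrow> real" and A B c :: real and g :: "real^2 \<Rightarrow> real^2^2"
  defines "\<omega> \<equiv> \<lambda>p. A * p$1 + B * p$2 + c"
    and "g \<equiv> \<lambda>p. form_matrix 1 (cos (\<omega> p)) 1"
begin

lemma angle_line:
  "\<omega> (p + t *\<^sub>R axis 1 1) = \<omega> p + A * t" "\<omega> (p + t *\<^sub>R axis 2 1) = \<omega> p + B * t"
  by (simp_all add: \<omega>_def axis_def algebra_simps)

lemma partial_metric:
  "partial i (\<lambda>q. g q $ 1 $ 1) p = 0" "partial i (\<lambda>q. g q $ 2 $ 2) p = 0"
  "partial 1 (\<lambda>q. g q $ 1 $ 2) p = - A * sin (\<omega> p)" "partial 2 (\<lambda>q. g q $ 1 $ 2) p = - B * sin (\<omega> p)"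
  "partial 1 (\<lambda>q. g q $ 2 $ 1) p = - A * sin (\<omega> p)" "partial 2 (\<lambda>q. g q $ 2 $ 1) p = - B * sin (\<omega> p)"
  unfolding g_def
  by (rule partial_eqI, auto simp: angle_line has_real_derivative_iff_has_vector_derivative[symmetric]
      intro!: derivative_eq_intros)+

lemma christoffel_Chebyshev:
  assumes "sin (\<omega> p) \<noteq> 0"
  shows "christoffel g 1 1 1 p = A * cos (\<omega> p) / sin (\<omega> p)"
    "christoffel g 2 1 1 p = - A / sin (\<omega> p)"
    "christoffel g k 1 2 p = 0" "christoffel g k 2 1 p = 0"
    "christoffel g 1 2 2 p = - B / sin (\<omega> p)"
    "christoffel g 2 2 2 p = B * cos (\<omega> p) / sin (\<omega> p)"
proof -
  have sq: "1 - (cos (\<omega> p))\<^sup>2 = (sin (\<omega> p))\<^sup>2"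
    by (simp add: sin_squared_eq)
  have inv: "matrix_inv (g p) = form_matrix (1 / (sin (\<omega> p))\<^sup>2)
      (- cos (\<omega> p) / (sin (\<omega> p))\<^sup>2) (1 / (sin (\<omega> p))\<^sup>2)"
    using assms matrix_inv_form_matrix[of 1 1 "cos (\<omega> p)"] by (simp add: g_def sq)
  show "christoffel g 1 1 1 p = A * cos (\<omega> p) / sin (\<omega> p)"
    "christoffel g 2 1 1 p = - A / sin (\<omega> p)"
    "christoffel g k 1 2 p = 0" "christoffel g k 2 1 p = 0"
    "christoffel g 1 2 2 p = - B / sin (\<omega> p)"
    "christoffel g 2 2 2 p = B * cos (\<omega> p) / sin (\<omega> p)"
    using assms
    by (simp_all add: christoffel_def sum_2 partial_metric inv power2_eq_square)
qed

lemma partial_christoffel_Chebyshev: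
  assumes "sin (\<omega> p) \<noteq> 0"
  shows "partial i (christoffel g k 1 2) p = 0"
    "partial 1 (christoffel g 1 2 2) p = A * B * cos (\<omega> p) / (sin (\<omega> p))\<^sup>2"
    "partial 1 (christoffel g 2 2 2) p = - A * B / (sin (\<omega> p))\<^sup>2"
proof -
  have cont: "((\<lambda>t. sin (\<omega> (p + t *\<^sub>R axis j 1))) \<longlongrightarrow> sin (\<omega> p)) (at 0)" for j
    unfolding \<omega>_def by (auto intro!: tendsto_eq_intros)
  have ev: "\<forall>\<^sub>F t in nhds 0. sin (\<omega> (p + t *\<^sub>R axis j 1)) \<noteq> 0" for j
    using tendsto_imp_eventually_ne[OF cont assms] assms
    by (simp add: eventually_nhds_conv_at)
  \<comment> \<open>The closed forms of the Christoffel symbols hold only where \<open>sin \<omega>\<close> does not vanish, which is a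
    neighbourhood of \<open>p\<close>; this suffices for partial derivatives at \<open>p\<close>.\<close>
  have transfer: "partial j (christoffel g k l m) p = d"
    if "((\<lambda>t. h (p + t *\<^sub>R axis j 1)) has_real_derivative d) (at 0)"
      and "\<And>q. sin (\<omega> q) \<noteq> 0 \<Longrightarrow> christoffel g k l m q = h q" for j k l m d h
    using that(1)
    by (intro partial_eqI, unfold has_real_derivative_iff_has_vector_derivative,
        subst has_vector_derivative_cong_ev[where g = "\<lambda>t. h (p + t *\<^sub>R axis j 1)"])
       (use ev[of j] that(2) in \<open>auto elim!: eventually_mono\<close>, use that(2)[OF assms] in simp)
  show "partial i (christoffel g k 1 2) p = 0"
    by (rule transfer[where h = "\<lambda>_. 0"]) (simp_all add: christoffel_Chebyshev)
  show "partial 1 (christoffel g 1 2 2) p = A * B * cos (\<omega> p) / (sin (\<omega> p))\<^sup>2"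
    by (rule transfer[where h = "\<lambda>q. - B / sin (\<omega> q)"])
       (use assms in \<open>auto simp: angle_line christoffel_Chebyshev power2_eq_square intro!: derivative_eq_intros\<close>)
  show "partial 1 (christoffel g 2 2 2) p = - A * B / (sin (\<omega> p))\<^sup>2"
  proof (rule transfer[where h = "\<lambda>q. B * cos (\<omega> q) / sin (\<omega> q)"])
    have "- (A * (B * (sin (\<omega> p))\<^sup>2)) = A * (B * (cos (\<omega> p))\<^sup>2) - A * B * ((cos (\<omega> p))\<^sup>2 + (sin (\<omega> p))\<^sup>2)"
      by (simp only: distrib_left)
    then show "((\<lambda>t. B * cos (\<omega> (p + t *\<^sub>R axis 1 1)) / sin (\<omega> (p + t *\<^sub>R axis 1 1)))
        has_real_derivative - A * B / (sin (\<omega> p))\<^sup>2) (at 0)"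
      using assms
      by (auto simp: angle_line power2_eq_square algebra_simps intro!: derivative_eq_intros)
  qed (simp add: christoffel_Chebyshev)
qed

lemma gauss_curvature_Chebyshev:
  assumes "sin (\<omega> p) \<noteq> 0"
  shows "gauss_curvature g p = 0"
proof -
  have "riemann g l 1 2 2 p = 0" for l
    using exhaust_2[of l] assms
    by (auto simp: riemann_def sum_2 christoffel_Chebyshev partial_christoffel_Chebyshev power2_eq_square)
  then show ?thesis
    by (simp add: gauss_curvature_def)
qed

end

section \<open>Partial derivatives of an immersion\<close>

lemma partial_eq_frechet_derivative:
  assumes "f differentiable (at p)"
  shows "partial i f p = frechet_derivative f (at p) (axis i 1)"
proof (rule partial_eqI)
  have "(f has_derivative frechet_derivative f (at p)) (at (p + 0 *\<^sub>R axis i 1))"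
    using assms by (simp add: frechet_derivative_works[symmetric])
  moreover have "((\<lambda>t. p + t *\<^sub>R axis i 1) has_derivative (\<lambda>t. t *\<^sub>R axis i 1)) (at 0)"
    by (auto intro!: derivative_eq_intros)
  ultimately have "((\<lambda>t. f (p + t *\<^sub>R axis i 1)) has_derivative
      (\<lambda>t. frechet_derivative f (at p) (t *\<^sub>R axis i 1))) (at 0)"
    using has_derivative_compose by blast
  moreover have "frechet_derivative f (at p) (t *\<^sub>R axis i 1) =
      t *\<^sub>R frechet_derivative f (at p) (axis i 1)" for t
    using linear_frechet_derivative[OF assms] by (simp add: linear_cmul)
  ultimately show "((\<lambda>t. f (p + t *\<^sub>R axis i 1)) has_vector_derivative
      frechet_derivative f (at p) (axis i 1)) (at 0)"
    by (simp add: has_vector_derivative_def)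
qed

text \<open>The derivative is injective and linear, so it maps the two coordinate directions to linearly
  independent vectors.\<close>

lemma immersion_partials_independent:
  assumes "immersion_on U X" "p \<in> U"
  shows "partial 1 X p \<noteq> k *\<^sub>R partial 2 X p"
proof
  let ?D = "frechet_derivative X (at p)"
  have diff: "X differentiable (at p)" and inj: "inj ?D"
    using assms by (auto simp: immersion_on_def)
  assume "partial 1 X p = k *\<^sub>R partial 2 X p"
  then have "?D (axis 1 1) = ?D (k *\<^sub>R axis 2 1)"
    using linear_frechet_derivative[OF diff]
    by (simp add: partial_eq_frechet_derivative[OF diff] linear_cmul)
  then have "(axis 1 1 :: real^2) = k *\<^sub>R axis 2 1"
    by (rule injD[OF inj])
  then show False
    by (auto simp: vec_eq_iff forall_2 axis_def)
qed

section \<open>The product surface\<close>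

text \<open>A vector field along the surface, moved to the identity quaternion by a left and a right
  translation.  Up to this identification \<open>X\<close>, its first partial derivatives and its normal are
  functions of at most one of the two parameters.\<close>

definition sandwich :: "real \<Rightarrow> real \<Rightarrow> (real^2 \<Rightarrow> real^4) \<Rightarrow> real^2 \<Rightarrow> real^4" where
  "sandwich a b m p = curve_left a (p$1) \<star> m p \<star> curve_right b (p$2)"

lemma inner_sandwich: "sandwich a b m p \<bullet> sandwich a b n p = m p \<bullet> n p"
  using norm_curve_left[of a "p$1"] norm_curve_right[of b "p$2"]
  by (simp add: sandwich_def inner_qmult_left inner_qmult_right norm_eq_1)

lemma has_vector_derivative_shift_0:
  assumes "(f has_vector_derivative d) (at x)"
  shows "((\<lambda>t. f (x + t)) has_vector_derivative d) (at 0)"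
proof -
  have "((\<lambda>t. x + t) has_derivative (\<lambda>t. t)) (at 0)"
    by (auto intro!: derivative_eq_intros)
  from has_derivative_compose[OF this, of f "\<lambda>t. t *\<^sub>R d"] show ?thesis
    using assms by (simp add: has_vector_derivative_def)
qed

text \<open>The product rule for \<open>c\<^sub>a(u) m(u, v) c\<^sub>b(v)\<close>: a derivative in \<open>u\<close> multiplies \<open>m\<close> by
  the velocity of \<open>c\<^sub>a\<close> from the left, a derivative in \<open>v\<close> multiplies it by the velocity of
  \<open>c\<^sub>b\<close> from the right.\<close>

lemma partial_sandwich:
  assumes "a \<noteq> 0" "b \<noteq> 0"
  shows "((\<lambda>t. m (p + t *\<^sub>R axis 1 1)) has_vector_derivative d) (at 0) \<Longrightarrow>
      partial 1 (sandwich a b m) p = sandwich a b (\<lambda>q. left_velocity a (q$1) \<star> m q + d) p"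
    and "((\<lambda>t. m (p + t *\<^sub>R axis 2 1)) has_vector_derivative d) (at 0) \<Longrightarrow>
      partial 2 (sandwich a b m) p = sandwich a b (\<lambda>q. d + m q \<star> right_velocity b (q$2)) p"
proof -
  have ax: "(p + t *\<^sub>R axis 1 1) $ 1 = p$1 + t" "(p + t *\<^sub>R axis 1 1) $ 2 = p$2"
    "(p + t *\<^sub>R axis 2 1) $ 1 = p$1" "(p + t *\<^sub>R axis 2 1) $ 2 = p$2 + t" for t
    by (simp_all add: axis_def)
  have L: "((\<lambda>t. curve_left a (p$1 + t)) has_vector_derivative
      curve_left a (p$1) \<star> left_velocity a (p$1)) (at 0)"
    by (intro has_vector_derivative_shift_0 curve_left_derivative assms)
  have R: "((\<lambda>t. curve_right b (p$2 + t)) has_vector_derivative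
      right_velocity b (p$2) \<star> curve_right b (p$2)) (at 0)"
    by (intro has_vector_derivative_shift_0 curve_right_derivative assms)
  show "partial 1 (sandwich a b m) p = sandwich a b (\<lambda>q. left_velocity a (q$1) \<star> m q + d) p"
    if "((\<lambda>t. m (p + t *\<^sub>R axis 1 1)) has_vector_derivative d) (at 0)"
    unfolding sandwich_def ax
    by (rule partial_eqI, unfold ax, rule has_vector_derivative_eq_rhs,
        rule bounded_linear.has_vector_derivative[OF qmult.bounded_linear_left],
        rule qmult.has_vector_derivative[OF L that])
       (simp add: qmult_assoc qmult.add_left qmult.add_right add.commute)
  show "partial 2 (sandwich a b m) p = sandwich a b (\<lambda>q. d + m q \<star> right_velocity b (q$2)) p"
    if "((\<lambda>t. m (p + t *\<^sub>R axis 2 1)) has_vector_derivative d) (at 0)"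
    unfolding sandwich_def ax
    by (rule partial_eqI, unfold ax, rule has_vector_derivative_eq_rhs,
        rule qmult.has_vector_derivative[OF _ R],
        rule bounded_linear.has_vector_derivative[OF qmult.bounded_linear_right that])
       (simp add: qmult_assoc qmult.add_left qmult.add_right add.commute)
qed

lemma product_surface_eq_sandwich: "product_surface a b = sandwich a b (\<lambda>_. quat_one)"
  by (simp add: fun_eq_iff product_surface_def sandwich_def)

lemma partial_product_surface:
  assumes "a \<noteq> 0" "b \<noteq> 0"
  shows "partial 1 (product_surface a b) = sandwich a b (\<lambda>p. left_velocity a (p$1))"
    and "partial 2 (product_surface a b) = sandwich a b (\<lambda>p. right_velocity b (p$2))"
  using assms
  by (auto simp: fun_eq_iff product_surface_eq_sandwich partial_sandwich[where d = 0] sandwich_def)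

text \<open>Both velocities are orthogonal to \<open>1\<close> and to \<open>i\<close>, so \<open>i\<close> and
  \<open>- i\<close> correspond to unit normals.  The second form below has its sign from the choice of \<open>- i\<close>.\<close>

definition surface_normal :: "real \<Rightarrow> real \<Rightarrow> real^2 \<Rightarrow> real^4" where
  "surface_normal a b = sandwich a b (\<lambda>_. vector [0, -1, 0, 0])"

text \<open>The off-diagonal coefficient is the inner product of the two velocities,
  \<open>- sin (A u + B v)\<close>; written as a cosine it has the phase constant \<open>pi / 2\<close>.\<close>

lemma first_form_product_surface:
  assumes "a \<noteq> 0" "b \<noteq> 0"
  shows "first_form (product_surface a b) p =
    form_matrix 1 (cos ((a - 1 / a) * p$1 + (b - 1 / b) * p$2 + pi / 2)) 1"
  by (simp add: vec_eq_iff forall_2 first_form_def partial_product_surface[OF assms] inner_sandwich)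
     (simp add: inner_4 left_velocity_def right_velocity_def cos_add sin_add flip: power2_eq_square)

text \<open>The mixed derivative corresponds to the product of the two velocities, which is
  \<open>- i e\<^sup>i\<^sup>(\<^sup>A\<^sup>u\<^sup>+\<^sup>B\<^sup>v\<^sup>)\<close> with \<open>i\<close>-component \<open>- cos (A u + B v)\<close>.  The pure second derivatives
  correspond to the square of a velocity, which is \<open>-1\<close>, plus its derivative, which is orthogonal
  to \<open>i\<close>; so their normal components vanish.\<close>

lemma second_form_product_surface:
  assumes "a \<noteq> 0" "b \<noteq> 0"
  shows "second_form (product_surface a b) (surface_normal a b) p =
    form_matrix 0 (sin ((a - 1 / a) * p$1 + (b - 1 / b) * p$2 + pi / 2)) 0"
proof -
  let ?L = "\<lambda>p::real^2. left_velocity a (p$1)" and ?R = "\<lambda>p::real^2. right_velocity b (p$2)"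
  let ?dL = "vector [0, 0, - ((a - 1 / a) * cos ((a - 1 / a) * p$1)),
      - ((a - 1 / a) * sin ((a - 1 / a) * p$1))] :: real^4"
  let ?dR = "vector [0, 0, - ((b - 1 / b) * sin ((b - 1 / b) * p$2)),
      - ((b - 1 / b) * cos ((b - 1 / b) * p$2))] :: real^4"
  have ax: "(p + t *\<^sub>R axis 1 1) $ 1 = p$1 + t" "(p + t *\<^sub>R axis 1 1) $ 2 = p$2"
    "(p + t *\<^sub>R axis 2 1) $ 1 = p$1" "(p + t *\<^sub>R axis 2 1) $ 2 = p$2 + t" for t
    by (simp_all add: axis_def)
  have "((\<lambda>t. ?L (p + t *\<^sub>R axis 1 1)) has_vector_derivative ?dL) (at 0)"
    "((\<lambda>t. ?R (p + t *\<^sub>R axis 1 1)) has_vector_derivative 0) (at 0)"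
    "((\<lambda>t. ?L (p + t *\<^sub>R axis 2 1)) has_vector_derivative 0) (at 0)"
    "((\<lambda>t. ?R (p + t *\<^sub>R axis 2 1)) has_vector_derivative ?dR) (at 0)"
    unfolding ax
    by (intro has_vector_derivative_shift_0 left_velocity_derivative right_velocity_derivative
        has_vector_derivative_const)+
  note d = this(1,2)[THEN partial_sandwich(1)[OF assms]] this(3,4)[THEN partial_sandwich(2)[OF assms]]
  show ?thesis
    by (simp add: vec_eq_iff forall_2 second_form_def partial_product_surface[OF assms]
        surface_normal_def d inner_sandwich)
       (simp add: inner_4 left_velocity_def right_velocity_def cos_add sin_add)
qed

text \<open>Where the sine vanishes, the two unit vectors \<open>X\<^sub>u\<close> and \<open>X\<^sub>v\<close> are equal or opposite, and
  \<open>X\<close> is not an immersion.\<close>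

lemma sin_angle_nonzero:
  assumes "a \<noteq> 0" "b \<noteq> 0" "immersion_on U (product_surface a b)" "p \<in> U"
  shows "sin ((a - 1 / a) * p$1 + (b - 1 / b) * p$2 + pi / 2) \<noteq> 0"
proof
  let ?w = "(a - 1 / a) * p$1 + (b - 1 / b) * p$2 + pi / 2"
  let ?X = "product_surface a b"
  let ?k = "partial 1 ?X p \<bullet> partial 2 ?X p"
  have "first_form ?X p $ 1 $ 1 = 1" "first_form ?X p $ 1 $ 2 = cos ?w" "first_form ?X p $ 2 $ 2 = 1"
    using first_form_product_surface[OF assms(1,2), of p] by simp_all
  then have E: "partial 1 ?X p \<bullet> partial 1 ?X p = 1" and F: "?k = cos ?w"
    and G: "partial 2 ?X p \<bullet> partial 2 ?X p = 1"
    by (simp_all add: first_form_def)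
  assume "sin ?w = 0"
  then have "(cos ?w)\<^sup>2 = 1"
    by (simp add: cos_squared_eq)
  then have "?k * ?k = 1"
    by (simp add: F power2_eq_square)
  then have "(partial 1 ?X p - ?k *\<^sub>R partial 2 ?X p) \<bullet> (partial 1 ?X p - ?k *\<^sub>R partial 2 ?X p) = 0"
    by (simp add: inner_diff_left inner_diff_right E G inner_commute)
  then show False
    using immersion_partials_independent[OF assms(3,4), of ?k] by simp
qed

lemma smooth_sandwich:
  assumes "open U"
  shows "smooth_on U (sandwich a b (\<lambda>_. w))"
proof -
  have lin: "bounded_linear (\<lambda>p::real^2. p$i / r)" "bounded_linear (\<lambda>p::real^2. r * p$i)" for i r
    by (intro bounded_linear_compose[OF bounded_linear_divide bounded_linear_vec_nth]
        bounded_linear_compose[OF bounded_linear_mult_right bounded_linear_vec_nth])+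
  have g: "smooth_on U (\<lambda>p. gamma_curve r (p$i))" for r i
    unfolding gamma_curve_def
    by (intro smooth_on_bounded_bilinear[OF bounded_bilinear_scaleR] smooth_on_vector_4
        smooth_on_bounded_bilinear[OF bounded_bilinear_mult] smooth_on_sin smooth_on_cos
        smooth_on_const lin assms)
  have h: "smooth_on U (\<lambda>p. swap34 (gamma_curve r (p$i)))" for r i
    unfolding gamma_curve_def swap34_def vector_scaleR_component vector_4 real_scaleR_def
    by (intro smooth_on_vector_4
        smooth_on_bounded_bilinear[OF bounded_bilinear_mult] smooth_on_sin smooth_on_cos
        smooth_on_const lin assms)
  show ?thesis
    unfolding sandwich_def[abs_def] curve_left_def curve_right_def
    by (intro smooth_on_bounded_bilinear[OF bounded_bilinear_scaleR]
        smooth_on_bounded_bilinear[OF qmult.bounded_bilinear_axioms] smooth_on_const g h assms)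
qed

lemma unit_normal_on_surface_normal:
  assumes "a \<noteq> 0" "b \<noteq> 0" "open U"
  shows "unit_normal_on U (product_surface a b) (surface_normal a b)"
  unfolding unit_normal_on_def forall_2 norm_eq_1 partial_product_surface[OF assms(1,2)]
  unfolding surface_normal_def product_surface_eq_sandwich inner_sandwich
  using smooth_sandwich[OF assms(3)] by (simp add: inner_4 left_velocity_def right_velocity_def)

lemma flat_product_surface:
  assumes "a \<noteq> 0" "b \<noteq> 0" "open U" "immersion_on U (product_surface a b)"
  shows "flat_surface_in_S3 U (product_surface a b)"
proof -
  have "product_surface a b ` U \<subseteq> sphere 0 1"
    by (auto simp: product_surface_def norm_qmult norm_curve_left norm_curve_right)
  moreover have "smooth_on U (product_surface a b)"
    unfolding product_surface_eq_sandwich by (rule smooth_sandwich[OF assms(3)])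
  moreover have "first_form (product_surface a b) =
      (\<lambda>p. form_matrix 1 (cos ((a - 1 / a) * p$1 + (b - 1 / b) * p$2 + pi / 2)) 1)"
    by (simp add: fun_eq_iff first_form_product_surface[OF assms(1,2)])
  ultimately show ?thesis
    using assms sin_angle_nonzero[OF assms(1,2,4)]
    by (simp add: flat_surface_in_S3_def gauss_curvature_Chebyshev)
qed

section \<open>Invariance under helicoidal motions\<close>

text \<open>A shift of \<open>u\<close> and a shift of \<open>v\<close> each act on their factor by a two-sided circle
  translation.  In the product the two inner circle elements meet; with the shifts
  \<open>(b - 1 / b) t\<close> and \<open>- (a - 1 / a) t\<close> they are inverse to each other, and what remains is a
  helicoidal motion of the product.  These shifts are the ones that keep the angle between the
  coordinate lines fixed.\<close>

lemma helicoidally_invariant_gamma_product: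
  assumes "a > 1" "b > 1"
  shows "helicoidally_invariant (\<lambda>p. gamma_curve a (p$1) \<star> swap34 (gamma_curve b (p$2)))"
proof -
  define d e where "d = b - 1 / b" and "e = a - 1 / a"
  define s r where "s = (a + 1 / a) * d / 2" and "r = - ((b + 1 / b) * e / 2)"
  have pos: "d > 0" "e > 0"
    using assms less_1_mult[of a a] less_1_mult[of b b] by (simp_all add: d_def e_def field_simps)
  moreover have "a + 1 / a > 0" "b + 1 / b > 0"
    using assms by (simp_all add: add_pos_pos)
  ultimately have "s > 0" "r < 0"
    by (simp_all add: s_def r_def)
  have smooth: "smooth_on UNIV (\<lambda>t::real. x + k * t)" for x k
    by (intro smooth_on_add smooth_on_const smooth_on_bounded_linear bounded_linear_mult_right open_UNIV)
  have orbit: "helicoidal (s + r) (s - r) t *v (gamma_curve a u \<star> swap34 (gamma_curve b v)) =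
      gamma_curve a (u + d * t) \<star> swap34 (gamma_curve b (v + - e * t))" for u v t
  proof -
    have angles: "(a + 1 / a) * (d * t) / 2 = s * t" "(a - 1 / a) * (d * t) / 2 = e * d * t / 2"
      "- ((b - 1 / b) * (- e * t) / 2) = e * d * t / 2" "(b + 1 / b) * (- e * t) / 2 = r * t"
      by (simp_all add: s_def r_def flip: d_def e_def)
    have shift: "gamma_curve a (u + d * t) =
        quat_cis (s * t) \<star> gamma_curve a u \<star> quat_cis (- (e * d * t / 2))"
      "swap34 (gamma_curve b (v + - e * t)) =
        quat_cis (e * d * t / 2) \<star> swap34 (gamma_curve b v) \<star> quat_cis (r * t)"
      using gamma_curve_shift[of a u "d * t", unfolded angles]
        swap34_gamma_curve_shift[of b v "- e * t", unfolded angles] assms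
      by simp_all
    have "quat_cis (- x) \<star> (quat_cis x \<star> z) = z" for x z
      by (simp add: qmult_assoc[symmetric] quat_cis_add[symmetric])
    then show ?thesis
      unfolding helicoidal_eq_qmult shift by (simp add: qmult_assoc)
  qed
  show ?thesis
    unfolding helicoidally_invariant_def
  proof (rule exI[of _ "s + r"], rule exI[of _ "s - r"], intro conjI allI)
    \<comment> \<open>The two rates differ in absolute value because neither outer circle element is trivial.
      This is where \<open>a\<close> and \<open>b\<close> have to be different from \<open>1\<close>.\<close>
    show "s + r \<noteq> s - r" "s + r \<noteq> - (s - r)"
      using \<open>s > 0\<close> \<open>r < 0\<close> by simp_all
    show "\<exists>f g. smooth_on UNIV f \<and> smooth_on UNIV g \<and> f 0 = u \<and> g 0 = v \<and>
        (\<forall>t. helicoidal (s + r) (s - r) t *v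
            (gamma_curve a ((vector [u, v] :: real^2) $ 1) \<star>
              swap34 (gamma_curve b ((vector [u, v] :: real^2) $ 2))) =
          gamma_curve a ((vector [f t, g t] :: real^2) $ 1) \<star>
            swap34 (gamma_curve b ((vector [f t, g t] :: real^2) $ 2)))"
      for u v :: real
      using smooth[of u d] smooth[of v "- e"] orbit
      by (intro exI[of _ "\<lambda>t. u + d * t"] exI[of _ "\<lambda>t. v + - e * t"]) simp
  qed
qed

text \<open>The rigid motion strips off the constant outer factors of the two curves.\<close>

lemma helicoidally_invariant_product_surface:
  assumes "a > 1" "b > 1"
  shows "\<exists>F. isometry_S3 F \<and> helicoidally_invariant (F \<circ> product_surface a b)"
proof -
  define P Q :: "real^4" where "P = (1 / sqrt (1 + a\<^sup>2)) *\<^sub>R vector [a, 0, -1, 0]"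
    and "Q = (1 / sqrt (1 + b\<^sup>2)) *\<^sub>R vector [b, 0, 0, -1]"
  have P: "norm P = 1" and Q: "norm Q = 1"
    unfolding P_def Q_def by (rule norm_normalized_vector_4, simp)+
  let ?F = "\<lambda>x. quat_conj P \<star> x \<star> quat_conj Q"
  have "product_surface a b p = P \<star> (gamma_curve a (p$1) \<star> swap34 (gamma_curve b (p$2))) \<star> Q" for p
    by (simp add: product_surface_def curve_left_def curve_right_def P_def Q_def
        qmult.scaleR_left qmult.scaleR_right qmult_assoc)
  then have "?F \<circ> product_surface a b = (\<lambda>p. gamma_curve a (p$1) \<star> swap34 (gamma_curve b (p$2)))"
    using quat_conj_cancel[OF P] quat_conj_cancel[OF Q] by (simp add: fun_eq_iff qmult_assoc)
  moreover have "isometry_S3 ?F"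
    using P Q by (intro isometry_S3_qmult) (simp_all add: norm_eq_1)
  ultimately show ?thesis
    using helicoidally_invariant_gamma_product[OF assms] by metis
qed

(* The two linear coefficients of the phase have the same sign.  With coefficients of opposite
   signs, (1 - a^2)/a and (b^2 - 1)/b, the two formulas hold for (u, v) |-> X(u, -v), not for X. *)
theorem theorem1:
  fixes a b :: real and U :: "(real^2) set" and X :: "real^2 \<Rightarrow> real^4"
  assumes "a > 1" and "b > 1"
    and X_eq: "X = product_surface a b"
    and "open U" and "immersion_on U X"
  shows "flat_surface_in_S3 U X
    \<and> (\<exists>c N. unit_normal_on U X N \<and>
         (\<forall>p\<in>U.
            first_form X p =
              form_matrix 1 (cos ((a\<^sup>2 - 1) / a * p$1 + (b\<^sup>2 - 1) / b * p$2 + c)) 1 \<and>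
            second_form X N p =
              form_matrix 0 (sin ((a\<^sup>2 - 1) / a * p$1 + (b\<^sup>2 - 1) / b * p$2 + c)) 0))
    \<and> (\<exists>F. isometry_S3 F \<and> helicoidally_invariant (F \<circ> X))"
proof -
  have nz: "a \<noteq> 0" "b \<noteq> 0"
    using assms by auto
  have coeff: "(r\<^sup>2 - 1) / r = r - 1 / r" if "r \<noteq> 0" for r :: real
    using that by (simp add: power2_eq_square diff_divide_distrib)
  show ?thesis
    unfolding X_eq coeff[OF nz(1)] coeff[OF nz(2)]
  proof (intro conjI exI[of _ "pi / 2"] exI[of _ "surface_normal a b"] ballI)
    show "flat_surface_in_S3 U (product_surface a b)"
      using assms by (intro flat_product_surface nz) simp_all
    show "unit_normal_on U (product_surface a b) (surface_normal a b)"
      by (intro unit_normal_on_surface_normal nz \<open>open U\<close>)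
  qed (simp_all only: first_form_product_surface[OF nz] second_form_product_surface[OF nz]
      helicoidally_invariant_product_surface[OF \<open>a > 1\<close> \<open>b > 1\<close>])
qed

end
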